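(* For any integers $k \geq 2$, $M \geq 0$, and $0 \leq \alpha,\beta \leq M$, $$U^M_{k,(\alpha,\beta)}(t) = C_{k,(\alpha,\beta)}(t) - \frac{C_{k,(\alpha,M)}(t) \, C_{k,(M+1,\beta)}(t)}{1+C_{k,(M+1,M)}(t)}.$$
   Context: For an integer $k\ge 2$ and integers $\alpha,\beta, n\ge 0$, let $\mathcal{D}^k_{n,(\alpha,\beta)}$ be the set of integer lattice paths from $(0,\alpha)$ to $(kn+\beta-\alpha,\beta)$ using steps $U=(1,1)$ and $D=(1,1-k)$ that stay weakly above the line $y=0$ (such paths have exactly $n$ steps $D$; the empty path is included when $n=0$, $\alpha=\beta$), $C^k_{n,(\alpha,\beta)}=|\mathcal{D}^k_{n,(\alpha,\beta)}|$ and $C_{k,(\alpha,\beta)}(t)=\sum_{n\ge0}C^k_{n,(\alpha,\beta)}t^n$. For $M\ge0$ and $0\le\alpha,\beta\le M$, $U^{k,M}_{n,(\alpha,\beta)}$ is the number of paths in $\mathcal{D}^k_{n,(\alpha,\beta)}$ that stay weakly below the line $y=M$, and $U^M_{k,(\alpha,\beta)}(t)=\sum_{n\ge0}U^{k,M}_{n,(\alpha,\beta)}t^n$. *)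

theory Defs
  imports "HOL-Computational_Algebra.Formal_Power_Series" "HOL-Library.Product_Plus"
begin

datatype step = U | D

fun step_vec :: "nat \<Rightarrow> step \<Rightarrow> int \<times> int" where
  "step_vec k U = (1, 1)"
| "step_vec k D = (1, 1 - int k)"

(* A lattice path is encoded by its starting point p and its list of steps s;
   path_point k p s i is its vertex after i steps. *)
definition path_point :: "nat \<Rightarrow> int \<times> int \<Rightarrow> step list \<Rightarrow> nat \<Rightarrow> int \<times> int" where
  "path_point k p s i = p + sum_list (map (step_vec k) (take i s))"

(* The endpoint is computed in int: when k * n + b < a its abscissa is negative and the set is
   empty.  A path is piecewise linear between its vertices, so constraints by horizontal lines
   need only be imposed at the vertices. *)
definition dyck_paths :: "nat \<Rightarrow> nat \<Rightarrow> nat \<Rightarrow> nat \<Rightarrow> step list set" where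
  "dyck_paths k n a b =
     {s. path_point k (0, int a) s (length s) = (int k * int n + int b - int a, int b)
         \<and> (\<forall>i\<le>length s. 0 \<le> snd (path_point k (0, int a) s i))}"

definition bounded_dyck_paths :: "nat \<Rightarrow> nat \<Rightarrow> nat \<Rightarrow> nat \<Rightarrow> nat \<Rightarrow> step list set" where
  "bounded_dyck_paths k M n a b =
     {s \<in> dyck_paths k n a b. \<forall>i\<le>length s. snd (path_point k (0, int a) s i) \<le> int M}"

lemma fst_path_point: "i \<le> length s \<Longrightarrow> fst (path_point k p s i) = fst p + int i"
proof -
  have "fst (sum_list (map (step_vec k) xs)) = int (length xs)" for xs
  proof (induction xs)
    case (Cons x xs)
    then show ?case by (cases x) auto
  qed simp
  then show "i \<le> length s \<Longrightarrow> fst (path_point k p s i) = fst p + int i"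
    by (simp add: path_point_def)
qed

lemma length_dyck_path:
  "s \<in> dyck_paths k n a b \<Longrightarrow> int (length s) = int k * int n + int b - int a"
  using fst_path_point[of "length s" s k "(0, int a)"] by (simp add: dyck_paths_def)

lemma finite_dyck_paths: "finite (dyck_paths k n a b)"
proof (rule finite_subset)
  let ?l = "nat (int k * int n + int b - int a)"
  show "dyck_paths k n a b \<subseteq> {s. set s \<subseteq> {U, D} \<and> length s = ?l}"
  proof
    fix s assume "s \<in> dyck_paths k n a b"
    then have "length s = ?l"
      by (metis length_dyck_path nat_int)
    moreover have "x \<in> {U, D}" for x
      by (cases x) simp_all
    then have "set s \<subseteq> {U, D}"
      by (rule subsetI)
    ultimately show "s \<in> {s. set s \<subseteq> {U, D} \<and> length s = ?l}"
      by (intro CollectI conjI)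
  qed
  show "finite {s. set s \<subseteq> {U, D} \<and> length s = ?l}"
    by (rule finite_lists_length_eq) simp
qed

(* The series have integer coefficients; they are taken over the field of rationals because
   division of formal power series in the library requires one. *)
definition C_series :: "nat \<Rightarrow> nat \<Rightarrow> nat \<Rightarrow> rat fps" where
  "C_series k a b = Abs_fps (\<lambda>n. of_nat (card (dyck_paths k n a b)))"

definition U_series :: "nat \<Rightarrow> nat \<Rightarrow> nat \<Rightarrow> nat \<Rightarrow> rat fps" where
  "U_series k M a b = Abs_fps (\<lambda>n. of_nat (card (bounded_dyck_paths k M n a b)))"

(* By this, 1 + C_series k (M + 1) M is a unit, so dividing by it is multiplication by its inverse. *)
lemma C_series_descent_nth_0: "fps_nth (C_series k (M + 1) M) 0 = 0"
proof -
  have "s \<notin> dyck_paths k 0 (M + 1) M" for s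
    using length_dyck_path[of s k 0 "M + 1" M] by auto
  then have "dyck_paths k 0 (M + 1) M = {}"
    by (simp only: set_eq_iff empty_iff not_False_eq_True simp_thms)
  then show ?thesis by (simp add: C_series_def)
qed

end

(* Cut a path that leaves the strip below height M just before its first vertex above M. Only an
   up-step can cross, so the path is a bounded path to height M, an up-step, and an arbitrary path
   from height M + 1.  Hence C(a,b) = U(a,b) + U(a,M) C(M+1,b); the case b = M gives
   U(a,M) = C(a,M) / (1 + C(M+1,M)). *)
theory Submission imports Defs begin

definition rise :: "nat \<Rightarrow> step list \<Rightarrow> int" where
  "rise k s = snd (sum_list (map (step_vec k) s))"

lemma rise_simps [simp]:
  "rise k [] = 0"
  "rise k (x # s) = snd (step_vec k x) + rise k s"
  "rise k (s @ s') = rise k s + rise k s'"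
  by (simp_all add: rise_def)

lemma snd_path_point: "snd (path_point k p s i) = snd p + rise k (take i s)"
  by (simp add: path_point_def rise_def)

text \<open>Every step adds 1, and a down-step takes away a further \<open>k\<close>. This links the
  endpoint's height to its abscissa, which is the length.\<close>

lemma rise_eq: "rise k s = int (length s) - int k * int (count_list s D)"
proof (induction s)
  case (Cons x s)
  then show ?case by (cases x) (simp_all add: algebra_simps)
qed simp

text \<open>The recursion replaces the quantifier over vertex indices, so that paths can be cut and
  joined by induction on the list. A set \<open>S\<close> of allowed heights treats the half-plane
  and the strip alike.\<close>

fun stays :: "nat \<Rightarrow> int set \<Rightarrow> int \<Rightarrow> step list \<Rightarrow> bool" where
  "stays k S a [] \<longleftrightarrow> a \<in> S"
| "stays k S a (x # s) \<longleftrightarrow> a \<in> S \<and> stays k S (a + snd (step_vec k x)) s"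

lemma stays_start: "stays k S a s \<Longrightarrow> a \<in> S"
  by (cases s) auto

lemma stays_append:
  "stays k S a (p @ q) \<longleftrightarrow> stays k S a p \<and> stays k S (a + rise k p) q"
  by (induction p arbitrary: a) (auto simp: add.assoc dest: stays_start)

lemma stays_mono: "stays k S a s \<Longrightarrow> S \<subseteq> T \<Longrightarrow> stays k T a s"
  by (induction s arbitrary: a) auto

lemma stays_iff: "stays k S a s \<longleftrightarrow> (\<forall>i\<le>length s. a + rise k (take i s) \<in> S)"
proof (induction s arbitrary: a)
  case (Cons x s)
  have "(\<forall>i\<le>length (x # s). a + rise k (take i (x # s)) \<in> S) \<longleftrightarrow>
      a \<in> S \<and> (\<forall>i\<le>length s. a + rise k (take (Suc i) (x # s)) \<in> S)"
    by (simp only: list.size add_Suc_right add_0_right less_Suc_eq_le [symmetric] All_less_Suc2)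
      (simp only: take_0 rise_simps add_0_right)
  then show ?case
    by (simp add: Cons.IH add.assoc)
qed simp

lemma mem_dyck_paths_iff:
  assumes "k > 0"
  shows "s \<in> dyck_paths k n a b \<longleftrightarrow>
    count_list s D = n \<and> int a + rise k s = int b \<and> stays k {0..} (int a) s"
proof -
  have "int k * int (count_list s D) = int k * int n \<longleftrightarrow> count_list s D = n"
    using assms by simp
  then show ?thesis
    by (auto simp: dyck_paths_def stays_iff prod_eq_iff fst_path_point snd_path_point rise_eq [of k s])
qed

lemma mem_bounded_dyck_paths_iff:
  assumes "k > 0"
  shows "s \<in> bounded_dyck_paths k M n a b \<longleftrightarrow>
    count_list s D = n \<and> int a + rise k s = int b \<and> stays k {0..int M} (int a) s"
  by (auto simp: bounded_dyck_paths_def mem_dyck_paths_iff [OF assms] stays_iff snd_path_point)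

text \<open>For positive \<open>k\<close> a down-step never rises and an up-step rises by exactly 1,
  so level \<open>m\<close> can only be passed by an up-step that starts at height \<open>m\<close>
  itself.\<close>

lemma first_crossing:
  assumes "k > 0" "stays k {0..} a s" "\<not> stays k {0..m} a s" "a \<le> m"
  shows "\<exists>p q. s = p @ U # q \<and> stays k {0..m} a p \<and> a + rise k p = m"
  using assms(2-)
proof (induction s arbitrary: a)
  case (Cons x s)
  let ?a = "a + snd (step_vec k x)"
  have s: "stays k {0..} ?a s" "\<not> stays k {0..m} ?a s" "a \<in> {0..m}"
    using Cons.prems by auto
  show ?case
  proof (cases "?a \<le> m")
    case True
    from Cons.IH [OF s(1,2) True] obtain p q
      where "s = p @ U # q" "stays k {0..m} ?a p" "?a + rise k p = m"
      by blast
    with s(3) show ?thesis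
      by (intro exI [of _ "x # p"] exI [of _ q]) (auto simp: add.assoc)
  next
    case False
    with \<open>k > 0\<close> s(3) have "x = U" "a = m"
      by (cases x; auto)+
    with s(3) show ?thesis
      by (intro exI [of _ "[]"] exI [of _ s]) auto
  qed
qed simp

lemma crossing_unique:
  assumes "p @ U # q = p' @ U # q'"
    and "stays k {0..m} a p" "a + rise k p = m"
    and "stays k {0..m} a p'" "a + rise k p' = m"
  shows "p = p' \<and> q = q'"
proof -
  \<comment> \<open>Here \<open>us\<close> is the surplus of the longer prefix over the shorter one
    \<open>r\<close>. If nonempty, it would begin with \<open>U\<close> at height \<open>m\<close>,
    giving the longer prefix a vertex at height \<open>m + 1\<close>.\<close>
  have no_overshoot: "us = []"
    if "us @ U # v = U # w" "stays k {0..m} a (r @ us)" "a + rise k r = m" for us v w r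
    using that by (cases us) (auto simp: stays_append dest: stays_start)
  from assms(1) obtain us
    where "p = p' @ us \<and> us @ U # q = U # q' \<or> p @ us = p' \<and> U # q = us @ U # q'"
    by (auto simp: append_eq_append_conv2)
  with assms no_overshoot [of us _ _ p] no_overshoot [of us _ _ p'] have "us = []"
    by metis
  with assms(1) \<open>_ \<or> _\<close> show ?thesis
    by auto
qed

text \<open>The index \<open>i\<close> counts the down-steps before the crossing. The crossing step
  is \<open>U\<close>, so the other \<open>n - i\<close> come after it. The map forgets
  \<open>i\<close>, but the prefix \<open>p\<close> determines it.\<close>

lemma bij_betw_crossing:
  assumes "k > 0" "a \<le> M"
  shows "bij_betw (\<lambda>(i, p, q). p @ U # q)
    (SIGMA i:{0..n}. bounded_dyck_paths k M i a M \<times> dyck_paths k (n - i) (M + 1) b)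
    (dyck_paths k n a b - bounded_dyck_paths k M n a b)" (is "bij_betw ?f ?A ?B")
proof (rule bij_betw_imageI)
  note mem = mem_dyck_paths_iff [OF assms(1)] mem_bounded_dyck_paths_iff [OF assms(1)]
  show "inj_on ?f ?A"
    by (rule inj_onI) (auto simp: mem dest: crossing_unique)
  show "?f ` ?A = ?B"
  proof (intro equalityI subsetI)
    fix s assume "s \<in> ?f ` ?A"
    \<comment> \<open>The joined path is not bounded: \<open>stays_start\<close> at the vertex just
      after the crossing would put \<open>1 + int M\<close> into \<open>{0..int M}\<close>.\<close>
    then show "s \<in> ?B"
      by (auto simp: mem stays_append algebra_simps stays_mono [where S = "{0..int M}"]
          dest!: stays_start [where a = "1 + int M"])
  next
    fix s assume s: "s \<in> ?B"
    then have "stays k {0..} (int a) s" "\<not> stays k {0..int M} (int a) s"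
      by (auto simp: mem)
    with first_crossing assms obtain p q
      where pq: "s = p @ U # q" "stays k {0..int M} (int a) p" "int a + rise k p = int M"
      by (metis of_nat_le_iff)
    with s have "(count_list p D, p, q) \<in> ?A"
      by (auto simp: mem stays_append algebra_simps)
    with pq(1) show "s \<in> ?f ` ?A"
      by force
  qed
qed

lemma card_dyck_paths_crossing:
  assumes "k > 0" "a \<le> M"
  shows "card (dyck_paths k n a b) = card (bounded_dyck_paths k M n a b) +
    (\<Sum>i=0..n. card (bounded_dyck_paths k M i a M) * card (dyck_paths k (n - i) (M + 1) b))"
proof -
  have sub: "bounded_dyck_paths k M m c d \<subseteq> dyck_paths k m c d" for m c d
    by (auto simp: bounded_dyck_paths_def)
  note fin = finite_dyck_paths finite_subset [OF sub finite_dyck_paths]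
  have "card (dyck_paths k n a b) = card (bounded_dyck_paths k M n a b) +
      card (dyck_paths k n a b - bounded_dyck_paths k M n a b)"
    using card_Diff_subset [OF fin(2) sub] card_mono [OF fin(1) sub] by simp
  also have "card (dyck_paths k n a b - bounded_dyck_paths k M n a b) =
      (\<Sum>i=0..n. card (bounded_dyck_paths k M i a M) * card (dyck_paths k (n - i) (M + 1) b))"
    by (subst bij_betw_same_card [OF bij_betw_crossing [OF assms], symmetric])
      (simp add: card_SigmaI fin card_cartesian_product)
  finally show ?thesis .
qed

lemma C_series_crossing:
  assumes "k > 0" "a \<le> M"
  shows "C_series k a b = U_series k M a b + U_series k M a M * C_series k (M + 1) b"
  by (rule fps_ext)
    (simp add: C_series_def U_series_def fps_mult_nth card_dyck_paths_crossing [OF assms])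

theorem theorem4p2:
  fixes k M \<alpha> \<beta> :: nat
  assumes "k \<ge> 2" and "\<alpha> \<le> M" and "\<beta> \<le> M"
  shows "U_series k M \<alpha> \<beta> =
    C_series k \<alpha> \<beta> - C_series k \<alpha> M * C_series k (M + 1) \<beta> / (1 + C_series k (M + 1) M)"
proof -
  let ?V = "1 + C_series k (M + 1) M"
  have cross: "C_series k \<alpha> b = U_series k M \<alpha> b + U_series k M \<alpha> M * C_series k (M + 1) b" for b
    using assms by (intro C_series_crossing) auto
  \<comment> \<open>The constant coefficient of \<open>?V\<close> is 1. Since the numerator is an
    exact multiple of \<open>?V\<close>, being nonzero suffices for the cancellation.\<close>
  have "?V \<noteq> 0"
    using C_series_descent_nth_0 [of k M] by (metis add_0_right fps_add_nth fps_one_nth fps_zero_nth zero_neq_one)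
  moreover have "C_series k \<alpha> M * C_series k (M + 1) \<beta> =
      (U_series k M \<alpha> M * C_series k (M + 1) \<beta>) * ?V"
    by (subst cross [of M]) (simp add: algebra_simps)
  ultimately have "C_series k \<alpha> M * C_series k (M + 1) \<beta> / ?V =
      U_series k M \<alpha> M * C_series k (M + 1) \<beta>"
    by (metis nonzero_mult_div_cancel_right)
  then show ?thesis
    using cross [of \<beta>] by simp
qed

end
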